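(* For every integer $n\geqslant1$, the sets $\Lambda_n^{\mathrm{even}}=\{2m+in: m\in\mathbb Z\}$ and $\Lambda_n^{\mathrm{odd}}=\{2m+1+in: m\in\mathbb Z\}$ are not sampling sets for $H^2$.
   Context: Lattice points $(m,n)\in\mathbb Z^2$ are identified with $m+in\in\mathbb C$. Let $\mathbb Z^2_+=\{m+in: m,n\in\mathbb Z,\ n\geqslant 0\}$. A function $f:\mathbb Z^2_+\to\mathbb C$ is discrete holomorphic, written $f\in\operatorname{Hol}(\mathbb Z^2_+)$, if $f(z)+i f(z+1)-f(z+1+i)-i f(z+i)=0$ for every $z\in\mathbb Z^2_+$. $H^2=H^2(\mathbb Z^2_+)=\{f\in\operatorname{Hol}(\mathbb Z^2_+): \|f\|_{H^2}:=\sup_{n\geqslant 0}\|f(\cdot+in)\|_{\ell^2(\mathbb Z)}<\infty\}$. A set $\Lambda\subseteq\mathbb Z^2_+$ is a sampling set for $H^2$ if there are constants $0<c\leqslant c'<\infty$ with $c\|f\|_{H^2}^2\leqslant\sum_{\lambda\in\Lambda}|f(\lambda)|^2\leqslant c'\|f\|_{H^2}^2$ for every $f\in H^2$. *)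

theory Defs
  imports "HOL-Analysis.Analysis"
begin

definition lattice_point :: "int \<Rightarrow> int \<Rightarrow> complex" where
  "lattice_point m n = of_int m + \<i> * of_int n"

definition Z2_plus :: "complex set" where
  "Z2_plus = {lattice_point m n | m n. n \<ge> 0}"

text \<open>
  A function on the upper half-lattice is represented by a total function on the complex plane.
  All notions below depend only on its values on \<open>Z2_plus\<close>.
\<close>

definition discrete_holomorphic :: "(complex \<Rightarrow> complex) \<Rightarrow> bool" where
  "discrete_holomorphic f \<longleftrightarrow>
     (\<forall>z\<in>Z2_plus. f z + \<i> * f (z + 1) - f (z + 1 + \<i>) - \<i> * f (z + \<i>) = 0)"

definition row_in_l2 :: "(complex \<Rightarrow> complex) \<Rightarrow> int \<Rightarrow> bool" where
  "row_in_l2 f n \<longleftrightarrow> (\<lambda>m::int. (cmod (f (lattice_point m n)))\<^sup>2) summable_on UNIV"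

text \<open>The two norms below are meaningful only if the rows are in \<open>l2\<close> and their norms bounded;
  this is part of membership in \<open>H2\<close>.\<close>

definition row_norm :: "(complex \<Rightarrow> complex) \<Rightarrow> int \<Rightarrow> real" where
  "row_norm f n = sqrt (\<Sum>\<^sub>\<infinity>m::int. (cmod (f (lattice_point m n)))\<^sup>2)"

definition H2_norm :: "(complex \<Rightarrow> complex) \<Rightarrow> real" where
  "H2_norm f = (SUP n\<in>{0..}. row_norm f n)"

definition H2 :: "(complex \<Rightarrow> complex) set" where
  "H2 = {f. discrete_holomorphic f \<and> (\<forall>n\<ge>0. row_in_l2 f n) \<and> bdd_above (row_norm f ` {0..})}"

text \<open>Summability over \<open>L\<close> is spelled out because \<open>infsum\<close> is \<open>0\<close> on non-summable families;
  it is what a finite upper bound for the series asserts.\<close>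

definition sampling_set :: "complex set \<Rightarrow> bool" where
  "sampling_set L \<longleftrightarrow> L \<subseteq> Z2_plus \<and>
     (\<exists>c c'. 0 < c \<and> c \<le> c' \<and>
       (\<forall>f\<in>H2. (\<lambda>z. (cmod (f z))\<^sup>2) summable_on L \<and>
          c * (H2_norm f)\<^sup>2 \<le> (\<Sum>\<^sub>\<infinity>z\<in>L. (cmod (f z))\<^sup>2) \<and>
          (\<Sum>\<^sub>\<infinity>z\<in>L. (cmod (f z))\<^sup>2) \<le> c' * (H2_norm f)\<^sup>2))"

definition Lambda_even :: "int \<Rightarrow> complex set" where
  "Lambda_even n = {lattice_point (2 * m) n | m. True}"

definition Lambda_odd :: "int \<Rightarrow> complex set" where
  "Lambda_odd n = {lattice_point (2 * m + 1) n | m. True}"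

text \<open>The inclusion in \<open>Z2_plus\<close> required of a sampling set holds for the sets considered,
  so it is never the reason why they fail to be sampling.\<close>

lemma Lambda_subset_Z2_plus:
  assumes "n \<ge> 0"
  shows "Lambda_even n \<subseteq> Z2_plus" and "Lambda_odd n \<subseteq> Z2_plus"
  using assms unfolding Lambda_even_def Lambda_odd_def Z2_plus_def by blast+

end

theory Submission
  imports Defs
begin

text \<open>
  The functions \<open>u\<^sup>m \<mu>\<^sup>n\<close> with \<open>u = cis t\<close> and \<open>\<mu> = cos t / (1 + sin t)\<close> are discrete
  holomorphic. Superposing them over a short arc of length \<open>2\<delta>\<close> around \<open>t = \<pi>/2\<close>, where
  \<open>\<bar>\<mu>\<bar> \<le> \<delta>\<close>, yields by Bessel's inequality a function in \<open>H2\<close> whose \<open>n\<close>-th row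
  (\<open>n \<ge> 1\<close>) has squared norm at most \<open>4 \<pi> \<delta>\<^sup>3\<close>, while its value \<open>2\<delta>\<close> at the origin bounds
  the \<open>H2\<close> norm from below. Letting \<open>\<delta>\<close> tend to \<open>0\<close> shows that no subset of the \<open>n\<close>-th row
  is a sampling set.
\<close>

section \<open>Bessel's inequality on an arc\<close>

lemma integral_cis_int:
  "integral {-pi..pi} (\<lambda>t. cis (of_int k * t)) = (if k = 0 then of_real (2 * pi) else 0)"
proof (cases "k = 0")
  case False
  have "((\<lambda>t. cis (of_int k * t)) has_integral
      (cis (of_int k * pi) / (\<i> * of_int k) - cis (of_int k * (- pi)) / (\<i> * of_int k))) {-pi..pi}"
  proof (rule fundamental_theorem_of_calculus)
    fix t :: real
    have "((\<lambda>t. exp (\<i> * of_int k * of_real t) / (\<i> * of_int k)) has_vector_derivative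
        exp (\<i> * of_int k * of_real t)) (at t within {-pi..pi})"
      using False
      by (auto intro!: derivative_eq_intros has_vector_derivative_real_field)
    then show "((\<lambda>t. cis (of_int k * t) / (\<i> * of_int k)) has_vector_derivative
        cis (of_int k * t)) (at t within {-pi..pi})"
      by (simp add: cis_conv_exp mult.assoc)
  qed simp
  \<comment> \<open>The two arguments differ by \<open>2 * pi * k\<close>, so the increment of the
    primitive vanishes.\<close>
  moreover have "cis (of_int k * pi) = cis (of_int k * (- pi))"
    by (simp add: complex_eq_iff sin_times_pi_eq_0)
  ultimately show ?thesis
    using False by (simp add: integral_unique)
qed (simp add: scaleR_conv_of_real)

text \<open>Parseval for finite sums: once the square is expanded into a double sum over
  \<open>m\<close> and \<open>k\<close>, orthogonality leaves only the diagonal.\<close>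

lemma integral_norm_trigonometric_polynomial:
  fixes d :: "int \<Rightarrow> complex"
  assumes "finite F"
  shows "integral {-pi..pi} (\<lambda>t. (cmod (\<Sum>m\<in>F. d m * cis (of_int m * t)))\<^sup>2)
    = 2 * pi * (\<Sum>m\<in>F. (cmod (d m))\<^sup>2)"
proof -
  define Q where "Q t = (\<Sum>m\<in>F. d m * cis (of_int m * t))" for t
  have sq: "complex_of_real ((cmod (Q t))\<^sup>2) =
      (\<Sum>m\<in>F. \<Sum>k\<in>F. d m * cnj (d k) * cis (of_int (m - k) * t))" for t
    unfolding complex_norm_square Q_def cnj_sum sum_product
    by (intro sum.cong refl) (simp add: cis_cnj cis_mult algebra_simps)
  have "complex_of_real (integral {-pi..pi} (\<lambda>t. (cmod (Q t))\<^sup>2))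
      = integral {-pi..pi} (\<lambda>t. complex_of_real ((cmod (Q t))\<^sup>2))"
    unfolding Q_def
    by (rule integral_linear[OF _ bounded_linear_of_real, symmetric, unfolded o_def])
      (auto intro!: integrable_continuous_interval continuous_intros)
  also have "\<dots> = (\<Sum>m\<in>F. \<Sum>k\<in>F. integral {-pi..pi}
      (\<lambda>t. d m * cnj (d k) * cis (of_int (m - k) * t)))"
    unfolding sq using assms
    by (subst integral_sum integral_sum[OF assms]; 
        (intro sum.cong refl integral_sum)?;
        auto intro!: integrable_sum integrable_continuous_interval continuous_intros)
  also have "\<dots> = (\<Sum>m\<in>F. \<Sum>k\<in>F. if m = k then d m * cnj (d k) * of_real (2 * pi) else 0)"
    by (intro sum.cong refl) (simp add: integral_cis_int del: of_int_diff)
  also have "\<dots> = complex_of_real (2 * pi * (\<Sum>m\<in>F. (cmod (d m))\<^sup>2))"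
    using assms by (simp add: complex_norm_square sum_distrib_left mult_ac del: of_real_power)
  finally show ?thesis
    unfolding Q_def of_real_eq_iff .
qed

text \<open>This is Bessel for the extension of \<open>g\<close> by zero to a full period. Comparing
  on the arc alone keeps every integrand continuous, which that extension need not be.\<close>

lemma bessel_inequality_arc:
  fixes g :: "real \<Rightarrow> complex"
  assumes "finite F" and "continuous_on {a..b} g" and "-pi \<le> a" "b \<le> pi"
  shows "(\<Sum>m\<in>F. (cmod (integral {a..b} (\<lambda>t. cis (of_int m * t) * g t)))\<^sup>2)
    \<le> 2 * pi * integral {a..b} (\<lambda>t. (cmod (g t))\<^sup>2)"
proof -
  define c where "c m = integral {a..b} (\<lambda>t. cis (of_int m * t) * g t)" for m :: int
  define S where "S = (\<Sum>m\<in>F. (cmod (c m))\<^sup>2)"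
  define G where "G = integral {a..b} (\<lambda>t. (cmod (g t))\<^sup>2)"
  \<comment> \<open>\<open>cnj (Q t) / (2 * pi)\<close> is the partial Fourier sum of the extended
    \<open>g\<close>; the conjugate appears because \<open>c m\<close> belongs to frequency
    \<open>-m\<close>.\<close>
  define Q where "Q t = (\<Sum>m\<in>F. cnj (c m) * cis (of_int m * t))" for t
  have contQ: "continuous_on A Q" for A
    unfolding Q_def by (intro continuous_intros)
  have intgQ: "integral {a..b} (\<lambda>t. g t * Q t) = of_real S"
  proof -
    have "integral {a..b} (\<lambda>t. g t * Q t)
        = integral {a..b} (\<lambda>t. \<Sum>m\<in>F. cnj (c m) * (cis (of_int m * t) * g t))"
      by (simp add: Q_def sum_distrib_left mult_ac)
    also have "\<dots> = (\<Sum>m\<in>F. cnj (c m) * c m)"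
      unfolding c_def using assms(1,2)
      by (subst integral_sum) (auto intro!: integrable_continuous_interval continuous_intros)
    also have "\<dots> = of_real S"
      by (simp add: S_def complex_norm_square mult.commute del: of_real_power)
    finally show ?thesis .
  qed
  have int_gQ: "(\<lambda>t. g t * Q t) integrable_on {a..b}"
    using assms(2) contQ by (intro integrable_continuous_interval continuous_intros)
  have intRe: "integral {a..b} (\<lambda>t. Re (g t * Q t)) = S"
    using integral_linear[OF int_gQ bounded_linear_Re] intgQ by (simp add: o_def)
  \<comment> \<open>The integrand is nonnegative, so the arc may be enlarged to a full period, where
    Parseval is exact.\<close>
  have intQ: "integral {a..b} (\<lambda>t. (cmod (Q t))\<^sup>2) \<le> 2 * pi * S"
  proof -
    have "integral {a..b} (\<lambda>t. (cmod (Q t))\<^sup>2) \<le> integral {-pi..pi} (\<lambda>t. (cmod (Q t))\<^sup>2)"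
      using assms(3,4) contQ
      by (intro integral_subset_le integrable_continuous_interval continuous_intros) auto
    also have "\<dots> = 2 * pi * S"
      unfolding Q_def S_def integral_norm_trigonometric_polynomial[OF assms(1)] by simp
    finally show ?thesis .
  qed
  have expand: "(cmod (of_real (2 * pi) * g t - cnj (Q t)))\<^sup>2
      = 4 * pi\<^sup>2 * (cmod (g t))\<^sup>2 - 4 * pi * Re (g t * Q t) + (cmod (Q t))\<^sup>2" for t
    unfolding cmod_power2 by (simp add: power2_eq_square algebra_simps)
  \<comment> \<open>The cross term yields \<open>- 4 * pi * S\<close> and the last integral at most
    \<open>2 * pi * S\<close>, which leaves the desired bound times \<open>2 * pi\<close>.\<close>
  have "0 \<le> integral {a..b} (\<lambda>t. (cmod (of_real (2 * pi) * g t - cnj (Q t)))\<^sup>2)"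
    by (intro Henstock_Kurzweil_Integration.integral_nonneg integrable_continuous_interval
        continuous_intros assms(2) contQ) auto
  also have "\<dots> = 4 * pi\<^sup>2 * G - 4 * pi * S + integral {a..b} (\<lambda>t. (cmod (Q t))\<^sup>2)"
    unfolding expand G_def
    by (subst integral_add integral_diff;
        (intro integrable_continuous_interval continuous_intros assms(2) contQ)?)+
      (simp add: intRe[symmetric])
  finally have "2 * pi * S \<le> 4 * pi\<^sup>2 * G"
    using intQ by linarith
  also have "\<dots> = 2 * pi * (2 * pi * G)"
    by (simp add: power2_eq_square)
  finally have "S \<le> 2 * pi * G"
    by (rule mult_left_le_imp_le) simp
  then show ?thesis
    by (simp add: S_def G_def c_def)
qed

section \<open>Discrete holomorphic wave packets\<close>

text \<open>Real form of (1 + iu) / (u + i) for \<open>u = cis t\<close>, with a zero at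
  \<open>pi/2\<close>.\<close>

definition row_multiplier :: "real \<Rightarrow> real" where
  "row_multiplier t = cos t / (1 + sin t)"

definition wave_packet_coeff :: "real \<Rightarrow> int \<Rightarrow> int \<Rightarrow> complex" where
  "wave_packet_coeff \<delta> m n = integral {pi/2 - \<delta>..pi/2 + \<delta>}
     (\<lambda>t. cis (of_int m * t) * of_real (row_multiplier t ^ nat n))"

text \<open>The floors recover the integer coordinates of a lattice point; values elsewhere are
  irrelevant to \<open>H2\<close>.\<close>

definition wave_packet :: "real \<Rightarrow> complex \<Rightarrow> complex" where
  "wave_packet \<delta> z = wave_packet_coeff \<delta> \<lfloor>Re z\<rfloor> \<lfloor>Im z\<rfloor>"

lemma wave_packet_lattice_point [simp]:
  "wave_packet \<delta> (lattice_point m n) = wave_packet_coeff \<delta> m n"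
  by (simp add: wave_packet_def lattice_point_def)

lemma sin_nonneg_near_half_pi:
  fixes t :: real
  assumes "\<bar>t - pi/2\<bar> \<le> 1"
  shows "sin t \<ge> 0"
  using assms pi_gt3 by (intro sin_ge_zero) (auto simp: abs_le_iff)

text \<open>Near \<open>pi/2\<close> the denominator is at least 1, and the numerator is a sine of
  the distance to \<open>pi/2\<close>.\<close>

lemma row_multiplier_bound:
  assumes "\<bar>t - pi/2\<bar> \<le> \<delta>" "\<delta> \<le> 1"
  shows "\<bar>row_multiplier t\<bar> \<le> \<delta>"
proof -
  have "sin t \<ge> 0"
    using assms by (intro sin_nonneg_near_half_pi) simp
  then have "\<bar>row_multiplier t\<bar> \<le> \<bar>cos t\<bar>"
    by (simp add: row_multiplier_def abs_divide divide_le_eq mult_le_cancel_left1)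
  also have "\<bar>cos t\<bar> = \<bar>sin (t - pi/2)\<bar>"
    by (simp add: sin_diff)
  also have "\<dots> \<le> \<delta>"
    using abs_sin_x_le_abs_x[of "t - pi/2"] assms by simp
  finally show ?thesis .
qed

text \<open>Inserting u^m \<mu>^n into the holomorphy equation and cancelling the common factor
  leaves exactly this identity; its real part is cos^2 = (1 - sin)(1 + sin).\<close>

lemma row_multiplier_eq:
  assumes "sin t \<ge> 0"
  shows "1 + \<i> * cis t = (cis t + \<i>) * of_real (row_multiplier t)"
proof -
  have "cos t * cos t = (1 - sin t) * (1 + sin t)"
    using sin_cos_squared_add3[of t] by (simp add: algebra_simps)
  then show ?thesis
    using assms by (auto simp: row_multiplier_def complex_eq_iff add_pos_nonneg field_simps)
qed

lemma continuous_on_row_multiplier: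
  assumes "\<delta> \<le> 1"
  shows "continuous_on {pi/2 - \<delta>..pi/2 + \<delta>} row_multiplier"
proof -
  have "1 + sin t \<noteq> 0" if "t \<in> {pi/2 - \<delta>..pi/2 + \<delta>}" for t
    using sin_nonneg_near_half_pi[of t] that assms by (auto simp: abs_le_iff)
  then show ?thesis
    unfolding row_multiplier_def by (intro continuous_intros) auto
qed

text \<open>The equation is linear, so it passes from the integrands to the integral.\<close>

lemma discrete_holomorphic_wave_packet:
  assumes "\<delta> \<le> 1"
  shows "discrete_holomorphic (wave_packet \<delta>)"
  unfolding discrete_holomorphic_def
proof
  fix z assume "z \<in> Z2_plus"
  then obtain m n where z: "z = lattice_point m n" and n: "n \<ge> 0"
    by (auto simp: Z2_plus_def)
  define J where "J = {pi/2 - \<delta>..pi/2 + \<delta>}"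
  define h where "h m n t = cis (of_int m * t) * of_real (row_multiplier t ^ nat n)"
    for m n :: int and t
  have int_h: "h m n integrable_on J" for m n
    unfolding h_def J_def
    by (intro integrable_continuous_interval continuous_intros
        continuous_on_row_multiplier assms)
  have shifts: "z + 1 = lattice_point (m + 1) n" "z + 1 + \<i> = lattice_point (m + 1) (n + 1)"
    "z + \<i> = lattice_point m (n + 1)"
    by (simp_all add: z lattice_point_def algebra_simps)
  have zero: "h m n t + \<i> * h (m + 1) n t - h (m + 1) (n + 1) t - \<i> * h m (n + 1) t = 0"
    if "t \<in> J" for t
  proof -
    have "sin t \<ge> 0"
      using that assms by (intro sin_nonneg_near_half_pi) (auto simp: J_def abs_le_iff)
    moreover have "cis (of_int (m + 1) * t) = cis (of_int m * t) * cis t"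
      by (simp add: cis_mult algebra_simps)
    ultimately have "h m n t + \<i> * h (m + 1) n t - h (m + 1) (n + 1) t - \<i> * h m (n + 1) t
      = cis (of_int m * t) * of_real (row_multiplier t ^ nat n) *
        ((1 + \<i> * cis t) - (cis t + \<i>) * of_real (row_multiplier t))"
      using n by (simp add: h_def nat_add_distrib algebra_simps)
    then show ?thesis
      using row_multiplier_eq[OF \<open>sin t \<ge> 0\<close>] by simp
  qed
  have "integral J (h m n) + \<i> * integral J (h (m + 1) n) - integral J (h (m + 1) (n + 1))
      - \<i> * integral J (h m (n + 1))
    = integral J (\<lambda>t. h m n t + \<i> * h (m + 1) n t - h (m + 1) (n + 1) t - \<i> * h m (n + 1) t)"
    by (simp add: integral_diff integral_add integrable_diff integrable_add
        integrable_on_mult_right int_h)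
  also have "\<dots> = 0"
    using zero by (simp cong: integral_cong)
  finally show "wave_packet \<delta> z + \<i> * wave_packet \<delta> (z + 1)
      - wave_packet \<delta> (z + 1 + \<i>) - \<i> * wave_packet \<delta> (z + \<i>) = 0"
    \<comment> \<open>\<open>shifts(2)\<close> goes first because \<open>shifts(1)\<close> would
      rewrite the subterm \<open>z + 1\<close> of its left-hand side.\<close>
    unfolding shifts(2) unfolding shifts(1,3) unfolding z wave_packet_lattice_point wave_packet_coeff_def
    by (simp add: J_def h_def[abs_def])
qed

text \<open>A row consists of Fourier integrals of a power of the multiplier over the arc. Bessel
  gives \<open>2 * pi\<close>, the arc length gives \<open>2 * \<delta>\<close>.\<close>

lemma wave_packet_row_finite_sum:
  assumes "0 \<le> \<delta>" "\<delta> \<le> 1" "finite F"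
  shows "(\<Sum>m\<in>F. (cmod (wave_packet_coeff \<delta> m n))\<^sup>2) \<le> 4 * pi * \<delta> * (\<delta> ^ nat n)\<^sup>2"
proof -
  have "(\<Sum>m\<in>F. (cmod (wave_packet_coeff \<delta> m n))\<^sup>2) \<le> 2 * pi * integral {pi/2 - \<delta>..pi/2 + \<delta>}
      (\<lambda>t. (cmod (of_real (row_multiplier t ^ nat n)))\<^sup>2)"
    unfolding wave_packet_coeff_def using assms pi_gt3
    by (intro bessel_inequality_arc continuous_intros continuous_on_row_multiplier) auto
  also have "\<dots> \<le> 2 * pi * integral {pi/2 - \<delta>..pi/2 + \<delta>} (\<lambda>t. (\<delta> ^ nat n)\<^sup>2)"
  proof (intro mult_left_mono integral_le)
    fix t assume "t \<in> {pi/2 - \<delta>..pi/2 + \<delta>}"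
    then have "\<bar>row_multiplier t\<bar> \<le> \<delta>"
      using assms(2) by (intro row_multiplier_bound) (auto simp: abs_le_iff)
    then show "(cmod (of_real (row_multiplier t ^ nat n)))\<^sup>2 \<le> (\<delta> ^ nat n)\<^sup>2"
      by (intro power_mono) (auto simp: norm_power power_abs intro!: power_mono)
  qed (auto intro!: integrable_continuous_interval continuous_intros
      continuous_on_row_multiplier assms(2))
  also have "\<dots> = 4 * pi * \<delta> * (\<delta> ^ nat n)\<^sup>2"
    using assms(1) by simp
  finally show ?thesis .
qed

lemma wave_packet_row_in_l2:
  assumes "0 \<le> \<delta>" "\<delta> \<le> 1"
  shows "row_in_l2 (wave_packet \<delta>) n"
  unfolding row_in_l2_def wave_packet_lattice_point
  using wave_packet_row_finite_sum[OF assms]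
  by (intro nonneg_bdd_above_summable_on bdd_aboveI2[where M = "4 * pi * \<delta> * (\<delta> ^ nat n)\<^sup>2"]) auto

lemma wave_packet_row_sum:
  assumes "0 \<le> \<delta>" "\<delta> \<le> 1"
  shows "(\<Sum>\<^sub>\<infinity>m. (cmod (wave_packet_coeff \<delta> m n))\<^sup>2) \<le> 4 * pi * \<delta> * (\<delta> ^ nat n)\<^sup>2"
  using wave_packet_row_in_l2[OF assms, of n] wave_packet_row_finite_sum[OF assms]
  by (intro infsum_le_finite_sums) (auto simp: row_in_l2_def)

lemma wave_packet_in_H2:
  assumes "0 \<le> \<delta>" "\<delta> \<le> 1"
  shows "wave_packet \<delta> \<in> H2"
proof -
  have "row_norm (wave_packet \<delta>) n \<le> sqrt (4 * pi * \<delta>)" for n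
  proof -
    have "(\<delta> ^ nat n)\<^sup>2 \<le> 1"
      using assms by (simp add: power_le_one)
    then have "4 * pi * \<delta> * (\<delta> ^ nat n)\<^sup>2 \<le> 4 * pi * \<delta>"
      using assms by (simp add: mult_left_le)
    then show ?thesis
      unfolding row_norm_def wave_packet_lattice_point
      using wave_packet_row_sum[OF assms, of n] by (intro real_sqrt_le_mono) linarith
  qed
  then show ?thesis
    using assms discrete_holomorphic_wave_packet wave_packet_row_in_l2
    by (auto simp: H2_def intro!: bdd_aboveI2)
qed

text \<open>One term is at most the whole row sum, and boundedness of the row norms makes the
  supremum an upper bound.\<close>

lemma norm_le_H2_norm:
  assumes "f \<in> H2" "n \<ge> 0"
  shows "cmod (f (lattice_point m n)) \<le> H2_norm f"
proof -
  have "(\<lambda>m. (cmod (f (lattice_point m n)))\<^sup>2) summable_on UNIV"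
    using assms by (auto simp: H2_def row_in_l2_def)
  then have "(\<Sum>m\<in>{m}. (cmod (f (lattice_point m n)))\<^sup>2)
      \<le> (\<Sum>\<^sub>\<infinity>m. (cmod (f (lattice_point m n)))\<^sup>2)"
    by (intro finite_sum_le_infsum) auto
  then have "cmod (f (lattice_point m n)) \<le> row_norm f n"
    unfolding row_norm_def by (intro real_le_rsqrt) simp
  also have "\<dots> \<le> H2_norm f"
    unfolding H2_norm_def using assms by (intro cSUP_upper) (auto simp: H2_def)
  finally show ?thesis .
qed

section \<open>Subsets of a row\<close>

lemma infsum_subset_row_le:
  assumes "L \<subseteq> range (\<lambda>m. lattice_point m n)" "row_in_l2 f n"
  shows "(\<Sum>\<^sub>\<infinity>z\<in>L. (cmod (f z))\<^sup>2) \<le> (\<Sum>\<^sub>\<infinity>m. (cmod (f (lattice_point m n)))\<^sup>2)"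
proof -
  have inj: "inj (\<lambda>m. lattice_point m n)"
    by (auto simp: inj_def lattice_point_def)
  have summable: "(\<lambda>z. (cmod (f z))\<^sup>2) summable_on range (\<lambda>m. lattice_point m n)"
    using assms(2) by (simp add: summable_on_reindex[OF inj] o_def row_in_l2_def)
  have "(\<Sum>\<^sub>\<infinity>z\<in>L. (cmod (f z))\<^sup>2) \<le> (\<Sum>\<^sub>\<infinity>z\<in>range (\<lambda>m. lattice_point m n). (cmod (f z))\<^sup>2)"
    using assms(1) summable summable_on_subset_banach[OF summable assms(1)]
    by (intro infsum_mono2) auto
  then show ?thesis
    by (simp add: infsum_reindex[OF inj] o_def)
qed

lemma not_sampling_set_subset_row:
  assumes "n \<ge> 1" "L \<subseteq> range (\<lambda>m. lattice_point m n)"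
  shows "\<not> sampling_set L"
proof
  assume "sampling_set L"
  then obtain c where c: "c > 0"
    and sampling: "\<And>f. f \<in> H2 \<Longrightarrow> c * (H2_norm f)\<^sup>2 \<le> (\<Sum>\<^sub>\<infinity>z\<in>L. (cmod (f z))\<^sup>2)"
    unfolding sampling_set_def by blast
  \<comment> \<open>The bound 1 keeps the arc where the multiplier estimates hold;
    \<open>c / 4\<close> contradicts the final \<open>c \<le> pi * \<delta>\<close>, as
    \<open>pi < 4\<close>.\<close>
  define \<delta> where "\<delta> = min 1 (c / 4)"
  have \<delta>: "0 < \<delta>" "\<delta> \<le> 1" "\<delta> \<le> c / 4"
    using c by (auto simp: \<delta>_def)
  have H2: "wave_packet \<delta> \<in> H2"
    using \<delta> by (intro wave_packet_in_H2) auto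
  \<comment> \<open>At the origin the integrand is constantly 1, so the value is the arc
    length.\<close>
  have "cmod (wave_packet \<delta> (lattice_point 0 0)) = 2 * \<delta>"
    using \<delta> by (simp add: wave_packet_coeff_def scaleR_conv_of_real norm_mult)
  then have "2 * \<delta> \<le> H2_norm (wave_packet \<delta>)"
    using norm_le_H2_norm[OF H2, of 0 0] by simp
  then have "c * (2 * \<delta>)\<^sup>2 \<le> c * (H2_norm (wave_packet \<delta>))\<^sup>2"
    using c \<delta> by (intro mult_left_mono power_mono) auto
  also have "\<dots> \<le> (\<Sum>\<^sub>\<infinity>z\<in>L. (cmod (wave_packet \<delta> z))\<^sup>2)"
    by (rule sampling[OF H2])
  also have "\<dots> \<le> 4 * pi * \<delta> * (\<delta> ^ nat n)\<^sup>2"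
    using infsum_subset_row_le[OF assms(2) wave_packet_row_in_l2[of \<delta>]]
      wave_packet_row_sum[of \<delta> n] \<delta>
    by simp
  \<comment> \<open>Here \<open>n \<ge> 1\<close> enters: it supplies the extra factor
    \<open>\<delta>\<^sup>2\<close> that beats the lower bound of order
    \<open>\<delta>\<^sup>2\<close>.\<close>
  also have "\<dots> \<le> 4 * pi * \<delta> * \<delta>\<^sup>2"
    using \<delta> assms(1) power_decreasing[of 1 "nat n" \<delta>] by (intro mult_left_mono power_mono) auto
  finally have "(4 * \<delta>\<^sup>2) * c \<le> (4 * \<delta>\<^sup>2) * (pi * \<delta>)"
    by (simp add: power2_eq_square algebra_simps)
  then have "c \<le> pi * \<delta>"
    by (rule mult_left_le_imp_le) (use \<delta> in simp)
  also have "\<dots> < 4 * \<delta>"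
    using \<delta> pi_less_4 by simp
  finally show False
    using \<delta> by simp
qed

theorem proposition7p4:
  fixes n :: int
  assumes "n \<ge> 1"
  shows "\<not> sampling_set (Lambda_even n) \<and> \<not> sampling_set (Lambda_odd n)"
  unfolding Lambda_even_def Lambda_odd_def
  by (intro conjI not_sampling_set_subset_row[OF assms]) auto

end
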